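(* Let $n,m\in\mathbb{N}$. Any frame in $\mathcal{F}(n,m)$ is arbitrarily close to a frame in $\mathcal{N}(n,m)$, i.e., for every $\Phi\in\mathcal{F}(n,m)$ and every $\varepsilon>0$ there is $\Phi'\in\mathcal{N}(n,m)$ with $\|\Phi-\Phi'\|<\varepsilon$. Moreover, the set $\mathcal{F}(n,m)\setminus\mathcal{N}(n,m)$ has measure zero in $\mathbb{K}^{n\times m}$.
   Context: $\mathbb{K}$ denotes $\mathbb{R}$ or $\mathbb{C}$. A frame for $\mathbb{K}^n$ with $m$ vectors is a family $(\phi_i)_{i=1}^m$ in $\mathbb{K}^n$ for which there are constants $0<A\le B$ with $A\|x\|_2^2\le\sum_{i=1}^m|\langle x,\phi_i\rangle|^2\le B\|x\|_2^2$ for all $x\in\mathbb{K}^n$; it is identified with the $n\times m$ matrix $\Phi$ whose columns are the $\phi_i$. A dual frame of $\Phi$ is a frame $\Psi\in\mathbb{K}^{n\times m}$ for $\mathbb{K}^n$ with $\Psi\Phi^*=I_n$. $\|\Psi\|_0$ denotes the number of nonzero entries of $\Psi$. $\mathcal{F}(n,m)\subset\mathbb{K}^{n\times m}$ is the set of all frames of $m$ vectors for $\mathbb{K}^n$. $\mathcal{N}(n,m)$ is the set of all $\Phi\in\mathcal{F}(n,m)$ whose sparsest dual has $n^2$ nonzero entries, i.e., such that the minimum of $\|\Psi\|_0$ over all dual frames $\Psi$ of $\Phi$ equals $n^2$. $\mathbb{K}^{n\times m}$ carries its Euclidean norm $\|\cdot\|$ and the induced Euclidean (Lebesgue) measure.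 *)

theory Defs
  imports "HOL-Analysis.Analysis"
begin

text \<open>The scalar field is \<open>real\<close> or \<open>complex\<close>; the class only lets the definitions be
  written once, with conjugation the identity on \<open>real\<close> and \<open>cnj\<close> on \<open>complex\<close>.\<close>

class scalar_field = real_normed_field + euclidean_space +
  fixes scnj :: "'a \<Rightarrow> 'a"
  assumes scnj_add: "scnj (x + y) = scnj x + scnj y"
    and scnj_mult: "scnj (x * y) = scnj x * scnj y"
    and scnj_scnj: "scnj (scnj x) = x"
    and mult_scnj: "x * scnj x = (norm x)\<^sup>2 *\<^sub>R 1"

instantiation real :: scalar_field
begin

definition scnj_real :: "real \<Rightarrow> real"
  where "scnj_real x = x"

instance
  by standard (simp_all add: scnj_real_def power2_eq_square)

end

instantiation complex :: scalar_field
begin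

definition scnj_complex :: "complex \<Rightarrow> complex"
  where "scnj_complex z = cnj z"

instance
  by standard (simp_all add: scnj_complex_def complex_norm_square [symmetric] scaleR_conv_of_real)

end

definition hinner :: "'k::scalar_field ^ 'n \<Rightarrow> 'k ^ 'n \<Rightarrow> 'k"
  where "hinner x y = (\<Sum>j\<in>UNIV. x $ j * scnj (y $ j))"

definition ctranspose :: "'k::scalar_field ^ 'm ^ 'n \<Rightarrow> 'k ^ 'n ^ 'm"
  where "ctranspose A = (\<chi> i j. scnj (A $ j $ i))"

text \<open>An \<open>n \<times> m\<close> matrix over \<open>'k\<close> has type \<open>'k ^ 'm ^ 'n\<close>, with \<open>CARD('n) = n\<close> and
  \<open>CARD('m) = m\<close>. Its \<open>norm\<close> is the Frobenius norm, that is, the Euclidean norm of the entries.\<close>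

definition is_frame :: "'k::scalar_field ^ 'm ^ 'n \<Rightarrow> bool"
  where "is_frame \<Phi> \<longleftrightarrow> (\<exists>A B. 0 < A \<and> A \<le> B \<and>
    (\<forall>x. A * (norm x)\<^sup>2 \<le> (\<Sum>i\<in>UNIV. (norm (hinner x (column i \<Phi>)))\<^sup>2) \<and>
         (\<Sum>i\<in>UNIV. (norm (hinner x (column i \<Phi>)))\<^sup>2) \<le> B * (norm x)\<^sup>2))"

definition frames :: "('k::scalar_field ^ 'm ^ 'n) set"
  where "frames = {\<Phi>. is_frame \<Phi>}"

definition is_dual_frame :: "'k::scalar_field ^ 'm ^ 'n \<Rightarrow> 'k ^ 'm ^ 'n \<Rightarrow> bool"
  where "is_dual_frame \<Phi> \<Psi> \<longleftrightarrow> is_frame \<Psi> \<and> \<Psi> ** ctranspose \<Phi> = mat 1"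

definition nnz :: "'k::zero ^ 'm ^ 'n \<Rightarrow> nat"
  where "nnz \<Psi> = card {(i, j). \<Psi> $ i $ j \<noteq> 0}"

text \<open>The two conditions say that the minimum of \<open>nnz\<close> over the dual frames is \<open>n\<^sup>2\<close>:
  this value is attained, and it is a lower bound.\<close>

definition frames_sparsest_dual_sq :: "('k::scalar_field ^ 'm ^ 'n) set"
  where "frames_sparsest_dual_sq = {\<Phi> \<in> frames.
    (\<exists>\<Psi>. is_dual_frame \<Phi> \<Psi> \<and> nnz \<Psi> = CARD('n)\<^sup>2) \<and>
    (\<forall>\<Psi>. is_dual_frame \<Phi> \<Psi> \<longrightarrow> CARD('n)\<^sup>2 \<le> nnz \<Psi>)}"

end

theory Submission
  imports Defs
begin

text \<open>Call a matrix \<open>\<Phi>\<close> degenerate if some standard basis vector is a linear combination of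
  fewer than \<open>n\<close> columns. If \<open>\<Phi>\<close> is not degenerate, each row of a dual has at least \<open>n\<close> nonzero
  entries; on the other hand some \<open>n\<close> columns of a frame form a basis, which yields a dual
  supported on \<open>n\<close> columns. Solving a relation \<open>e\<^sub>k = \<Sum>\<^bsub>l\<in>S\<^esub> c\<^sub>l \<phi>\<^sub>l\<close> with \<open>|S| < n\<close> for one of
  the \<open>\<phi>\<^sub>l\<close> exhibits the degenerate matrices as a finite union of subsets of polynomial
  images of hyperplanes, so they form a negligible set. Density follows as the frames form an
  open set.\<close>

section \<open>Conjugation, frames and dual frames\<close>

lemma scnj_0 [simp]: "scnj (0::'k::scalar_field) = 0"
  using scnj_add[of 0 "0::'k"] by simp

lemma scnj_1 [simp]: "scnj (1::'k::scalar_field) = 1"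
  using mult_scnj[of "1::'k"] by simp

lemma scnj_eq_0_iff [simp]: "scnj (x::'k::scalar_field) = 0 \<longleftrightarrow> x = 0"
  by (metis scnj_0 scnj_scnj)

lemma scnj_diff: "scnj (x - y) = scnj x - scnj (y::'k::scalar_field)"
  using scnj_add[of "x - y" y] by (simp add: algebra_simps)

lemma scnj_sum: "scnj (\<Sum>i\<in>A. f i) = (\<Sum>i\<in>A. scnj (f i :: 'k::scalar_field))"
  by (induction A rule: infinite_finite_induct) (auto simp: scnj_add)

lemma norm_scnj [simp]: "norm (scnj x) = norm (x::'k::scalar_field)"
proof (cases "x = 0")
  case False
  have "norm x * norm (scnj x) = norm x * norm x"
    using arg_cong[OF mult_scnj[of x], of norm] by (simp add: norm_mult power2_eq_square)
  with False show ?thesis by simp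
qed simp

lemma continuous_on_scnj [continuous_intros]:
  fixes f :: "'a::topological_space \<Rightarrow> 'k::scalar_field"
  assumes "continuous_on S f"
  shows "continuous_on S (\<lambda>x. scnj (f x))"
proof -
  have "1-lipschitz_on UNIV (scnj :: 'k \<Rightarrow> 'k)"
    by (rule lipschitz_onI) (auto simp: dist_norm simp flip: scnj_diff)
  from continuous_on_compose2[OF lipschitz_on_continuous_on[OF this] assms]
  show ?thesis by simp
qed

lemma ctranspose_ctranspose [simp]: "ctranspose (ctranspose A) = A"
  by (simp add: ctranspose_def vec_eq_iff scnj_scnj)

lemma ctranspose_mat_1 [simp]: "ctranspose (mat 1) = mat 1"
  by (simp add: ctranspose_def vec_eq_iff mat_def)

lemma ctranspose_mult: "ctranspose (A ** B) = ctranspose B ** ctranspose A"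
  by (simp add: ctranspose_def vec_eq_iff matrix_matrix_mult_def scnj_sum scnj_mult mult.commute)

lemma linear_matrix_vector_mult:
  fixes A :: "'k::scalar_field ^ 'm ^ 'n"
  shows "linear ((*v) A)"
  by (rule linearI)
    (simp_all add: matrix_vector_mult_def vec_eq_iff distrib_left sum.distrib scaleR_right.sum)

text \<open>The matrix \<open>ctranspose \<Phi>\<close> is the analysis operator of the frame, so
  frame bounds become norm bounds on this operator.\<close>

lemma sum_norm_hinner_column:
  "(\<Sum>i\<in>UNIV. (norm (hinner x (column i \<Phi>)))\<^sup>2) = (norm (ctranspose \<Phi> *v x))\<^sup>2"
  by (simp add: norm_vec_def L2_set_def sum_nonneg hinner_def ctranspose_def column_def
      matrix_vector_mult_def mult.commute)

text \<open>A positive lower bound forces the analysis operator to have trivial kernel, hence a left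
  inverse. Conversely, boundedness of a left inverse gives the lower bound and boundedness of the
  operator itself gives the upper one.\<close>

lemma is_frame_iff_left_invertible:
  fixes \<Phi> :: "'k::scalar_field ^ 'm ^ 'n"
  shows "is_frame \<Phi> \<longleftrightarrow> (\<exists>\<Psi>. \<Psi> ** ctranspose \<Phi> = mat 1)"
proof
  assume "is_frame \<Phi>"
  then obtain A where "0 < A" and A: "\<And>x. A * (norm x)\<^sup>2 \<le> (norm (ctranspose \<Phi> *v x))\<^sup>2"
    unfolding is_frame_def sum_norm_hinner_column by blast
  have "x = 0" if "ctranspose \<Phi> *v x = 0" for x
    using A[of x] \<open>0 < A\<close> by (auto simp: that mult_le_0_iff)
  then show "\<exists>\<Psi>. \<Psi> ** ctranspose \<Phi> = mat 1"
    by (simp add: matrix_left_invertible_ker)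
next
  assume "\<exists>\<Psi>. \<Psi> ** ctranspose \<Phi> = mat 1"
  then obtain \<Psi> where \<Psi>: "\<Psi> ** ctranspose \<Phi> = mat 1" ..
  obtain C where "C > 0" and C: "\<And>y. norm (\<Psi> *v y) \<le> C * norm y"
    using linear_bounded_pos[OF linear_matrix_vector_mult[of \<Psi>]] by blast
  obtain D where "D > 0" and D: "\<And>x. norm (ctranspose \<Phi> *v x) \<le> D * norm x"
    using linear_bounded_pos[OF linear_matrix_vector_mult[of "ctranspose \<Phi>"]] by blast
  have lower: "1 / C\<^sup>2 * (norm x)\<^sup>2 \<le> (norm (ctranspose \<Phi> *v x))\<^sup>2" for x
  proof -
    have "norm x \<le> C * norm (ctranspose \<Phi> *v x)"
      using C[of "ctranspose \<Phi> *v x"] by (simp add: matrix_vector_mul_assoc \<Psi>)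
    then have "(norm x)\<^sup>2 \<le> C\<^sup>2 * (norm (ctranspose \<Phi> *v x))\<^sup>2"
      by (metis norm_ge_zero power_mono power_mult_distrib)
    with \<open>C > 0\<close> show ?thesis by (simp add: field_simps)
  qed
  \<comment> \<open>The maximum secures \<open>A \<le> B\<close> without a comparison of
    \<open>C\<close> and \<open>D\<close>.\<close>
  have upper: "(norm (ctranspose \<Phi> *v x))\<^sup>2 \<le> max (1 / C\<^sup>2) (D\<^sup>2) * (norm x)\<^sup>2" for x
  proof -
    have "(norm (ctranspose \<Phi> *v x))\<^sup>2 \<le> D\<^sup>2 * (norm x)\<^sup>2"
      by (metis D norm_ge_zero power_mono power_mult_distrib)
    also have "\<dots> \<le> max (1 / C\<^sup>2) (D\<^sup>2) * (norm x)\<^sup>2"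
      by (intro mult_right_mono) auto
    finally show ?thesis .
  qed
  show "is_frame \<Phi>"
    unfolding is_frame_def sum_norm_hinner_column
    by (rule exI[of _ "1 / C\<^sup>2"], rule exI[of _ "max (1 / C\<^sup>2) (D\<^sup>2)"])
      (use \<open>C > 0\<close> lower upper in auto)
qed

text \<open>Transposing the duality equation shows that \<open>\<Phi>\<close> is a left inverse of
  \<open>ctranspose \<Psi>\<close>, so \<open>\<Psi>\<close> is automatically a frame.\<close>

lemma is_dual_frame_iff: "is_dual_frame \<Phi> \<Psi> \<longleftrightarrow> \<Psi> ** ctranspose \<Phi> = mat 1"
proof -
  have "is_frame \<Psi>" if "\<Psi> ** ctranspose \<Phi> = mat 1"
    using arg_cong[OF that, of ctranspose] is_frame_iff_left_invertible
    by (auto simp: ctranspose_mult)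
  then show ?thesis by (auto simp: is_dual_frame_def)
qed

lemma open_frames: "open (frames :: ('k::scalar_field ^ 'm ^ 'n) set)"
proof -
  have "open {\<Phi> :: 'k ^ 'm ^ 'n. det (\<Psi> ** ctranspose \<Phi>) \<noteq> 0}" for \<Psi>
    unfolding det_def matrix_matrix_mult_def ctranspose_def
    by (intro open_Collect_neq) (auto intro!: continuous_intros)
  \<comment> \<open>An invertible \<open>\<Psi> ** ctranspose \<Phi>\<close> can be normalised to
    the identity by multiplying \<open>\<Psi>\<close> from the left with its inverse.\<close>
  moreover have "frames = (\<Union>\<Psi>. {\<Phi> :: 'k ^ 'm ^ 'n. det (\<Psi> ** ctranspose \<Phi>) \<noteq> 0})"
    unfolding frames_def is_frame_iff_left_invertible
    by (auto simp flip: invertible_det_nz simp: invertible_left_inverse matrix_mul_assoc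
        intro: exI[of _ "mat 1"]) (metis matrix_mul_lid)
  ultimately show ?thesis by (metis (no_types, lifting) open_UN)
qed

section \<open>A dual supported on n columns\<close>

lemma nnz_eq_sum: "nnz (A :: 'k::zero ^ 'm ^ 'n) = (\<Sum>i\<in>UNIV. card {j. A $ i $ j \<noteq> 0})"
proof -
  have "{(i, j). A $ i $ j \<noteq> 0} = (SIGMA i:UNIV. {j. A $ i $ j \<noteq> 0})" by auto
  then show ?thesis by (simp add: nnz_def)
qed

text \<open>The rows of \<open>A\<close> span the whole space, so some of them form a basis. Writing
  each standard basis vector in this basis gives the rows of \<open>B'\<close>.\<close>

lemma matrix_left_invertible_sparse:
  fixes A :: "'k::field ^ 'n ^ 'm"
  assumes "B ** A = mat 1"
  obtains B' J where "B' ** A = mat 1" "card J = CARD('n)" "\<And>i j. j \<notin> J \<Longrightarrow> B' $ i $ j = 0"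
proof -
  have span: "vec.span (rows A) = UNIV"
    using assms matrix_left_invertible_span_rows_gen by blast
  obtain R where R: "R \<subseteq> rows A" "vec.independent R" "rows A \<subseteq> vec.span R"
    using vec.maximal_independent_subset by blast
  have spanR: "vec.span R = UNIV"
    by (metis R(3) span top.extremum_uniqueI vec.span_minimal vec.subspace_span)
  have "card R = CARD('n)"
    by (metis R(2) vec.basis_card_eq_dim spanR subset_UNIV vec_dim_card order_refl)
  have "finite R" using R(2) vec.finiteI_independent by blast
  \<comment> \<open>\<open>R\<close> is a set of vectors, and several indices may carry the same
    row. \<open>h\<close> picks one index for each vector, so that exactly n columns of
    \<open>B'\<close> are used.\<close>
  obtain h where h: "\<And>b. b \<in> R \<Longrightarrow> row (h b) A = b"
    using R(1) unfolding rows_def subset_iff by (auto; metis)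
  then have inj: "inj_on h R" by (metis inj_onI)
  have "\<exists>u. \<forall>k. (\<Sum>b\<in>R. u k b *s b) = axis k 1"
    using spanR vec.span_finite[OF \<open>finite R\<close>]
    by (intro choice allI) (metis (mono_tags, lifting) UNIV_I imageE)
  then obtain u where u: "\<And>k. (\<Sum>b\<in>R. u k b *s b) = axis k 1" by blast
  define B' :: "'k ^ 'm ^ 'n"
    where "B' = (\<chi> k j. if j \<in> h ` R then u k (the_inv_into R h j) else 0)"
  have "(B' ** A) $ k $ i = mat 1 $ k $ i" for k i
  proof -
    have "(B' ** A) $ k $ i = (\<Sum>j\<in>h ` R. u k (the_inv_into R h j) * A $ j $ i)"
      unfolding B'_def matrix_matrix_mult_def
      by (auto simp: if_distrib[of "\<lambda>x. x * _"] sum.If_cases cong: if_cong)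
    also have "\<dots> = (\<Sum>b\<in>R. u k b * A $ h b $ i)"
      by (simp add: sum.reindex[OF inj] the_inv_into_f_f[OF inj])
    also have "\<dots> = (\<Sum>b\<in>R. u k b * b $ i)"
      by (intro sum.cong refl) (metis h row_def vec_lambda_eta)
    also have "\<dots> = (\<Sum>b\<in>R. u k b *s b) $ i" by simp
    finally show ?thesis by (simp add: u axis_def mat_def eq_commute)
  qed
  then have "B' ** A = mat 1" by (simp add: vec_eq_iff)
  moreover have "card (h ` R) = CARD('n)"
    using card_image[OF inj] \<open>card R = CARD('n)\<close> by simp
  moreover have "B' $ i $ j = 0" if "j \<notin> h ` R" for i j using that by (simp add: B'_def)
  ultimately show thesis using that by blast
qed

section \<open>Negligibility of the degenerate matrices\<close>

lemma differentiable_vec_lambda: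
  fixes f :: "'i::finite \<Rightarrow> 'a::real_normed_vector \<Rightarrow> 'b::euclidean_space"
  assumes "\<And>i. f i differentiable (at x within S)"
  shows "(\<lambda>x. \<chi> i. f i x) differentiable (at x within S)"
proof (subst differentiable_componentwise_within, intro ballI)
  fix b :: "'b ^ 'i"
  assume "b \<in> Basis"
  then obtain i c where b: "b = axis i c" "c \<in> Basis" by (auto simp: Basis_vec_def)
  show "(\<lambda>x. (\<chi> i. f i x) \<bullet> b) differentiable at x within S"
    using iffD1[OF differentiable_componentwise_within assms[of i]] b by (simp add: inner_axis)
qed

text \<open>The condition on \<open>c j0\<close> allows the relation to be solved for column
  \<open>j0\<close>.\<close>

definition cols_span_axis :: "'n \<Rightarrow> 'm set \<Rightarrow> 'm \<Rightarrow> ('k::scalar_field ^ 'm ^ 'n) set"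
  where "cols_span_axis k S j0 =
    {\<Phi>. \<exists>c. c j0 \<noteq> 0 \<and> (\<forall>i. (\<Sum>j\<in>S. c j * \<Phi> $ i $ j) = (if i = k then 1 else 0))}"

lemma negligible_cols_span_axis:
  assumes "card S < CARD('n)" and "j0 \<in> S"
  shows "negligible (cols_span_axis k S j0 :: ('k::scalar_field ^ 'm ^ 'n) set)"
proof -
  \<comment> \<open>Storage plan for column \<open>j0\<close>: row \<open>k\<close> will hold
    \<open>1 / c j0\<close>, and row \<open>\<tau> l\<close> the coefficient of column
    \<open>l\<close>. As \<open>card S\<close> is less than n, \<open>\<tau>\<close> can avoid
    \<open>k\<close>, which leaves row \<open>\<tau> j0\<close> free.\<close>
  have "card S \<le> card (UNIV - {k :: 'n})" using assms(1) by (simp add: card_Diff_singleton)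
  then obtain \<tau> where \<tau>: "\<tau> ` S \<subseteq> UNIV - {k}" "inj_on \<tau> S"
    using card_le_inj[of S "UNIV - {k :: 'n}"] by auto
  \<comment> \<open>The column \<open>j0\<close> of the argument of \<open>F\<close> holds the coefficients that express the new
    column \<open>j0\<close>; its entry at row \<open>\<tau> j0\<close> is not used.\<close>
  define F :: "'k ^ 'm ^ 'n \<Rightarrow> 'k ^ 'm ^ 'n" where
    "F X = (\<chi> i j. if j = j0 then (if i = k then X $ k $ j0 else 0) +
              (\<Sum>l\<in>S-{j0}. X $ \<tau> l $ j0 * X $ i $ l) else X $ i $ j)" for X
  \<comment> \<open>Setting a single real coordinate of the free entry to zero already gives a real
    hyperplane, also for complex scalars.\<close>
  obtain b :: 'k where "b \<in> Basis" using nonempty_Basis by blast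
  let ?H = "{X :: 'k ^ 'm ^ 'n. axis (\<tau> j0) (axis j0 b) \<bullet> X = 0}"
  have "axis (\<tau> j0) (axis j0 b) \<noteq> (0 :: 'k ^ 'm ^ 'n)"
    using nonzero_Basis[OF \<open>b \<in> Basis\<close>] by simp
  then have "negligible ?H" by (intro negligible_hyperplane) simp
  moreover have "F differentiable_on ?H"
    unfolding differentiable_on_def F_def
  proof (intro ballI differentiable_vec_lambda)
    have entry: "(\<lambda>X. X $ i $ j) differentiable at X within T"
      for i j T and X :: "'k ^ 'm ^ 'n"
      by (intro bounded_linear_imp_differentiable
          bounded_linear_compose[OF bounded_linear_vec_nth bounded_linear_vec_nth])
    fix X i j
    show "(\<lambda>X. if j = j0 then (if i = k then X $ k $ j0 else 0) +
        (\<Sum>l\<in>S-{j0}. X $ \<tau> l $ j0 * X $ i $ l) else X $ i $ j) differentiable at X within ?H"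
      by (cases "j = j0"; cases "i = k")
        (auto intro!: entry differentiable_add differentiable_sum differentiable_mult)
  qed
  ultimately have "negligible (F ` ?H)"
    by (intro negligible_differentiable_image_negligible) auto
  moreover have "cols_span_axis k S j0 \<subseteq> F ` ?H"
  proof
    fix \<Phi> :: "'k ^ 'm ^ 'n"
    assume "\<Phi> \<in> cols_span_axis k S j0"
    then obtain c where "c j0 \<noteq> 0"
      and c: "\<And>i. (\<Sum>j\<in>S. c j * \<Phi> $ i $ j) = (if i = k then 1 else 0)"
      by (auto simp: cols_span_axis_def)
    \<comment> \<open>Dividing the relation by \<open>c j0\<close> gives these coefficients. The
      default 0 covers row \<open>\<tau> j0\<close>, which puts \<open>X\<close> into the
      hyperplane.\<close>
    define X :: "'k ^ 'm ^ 'n" where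
      "X = (\<chi> i j. if j \<noteq> j0 then \<Phi> $ i $ j else if i = k then 1 / c j0
              else if i \<in> \<tau> ` (S - {j0}) then - c (the_inv_into S \<tau> i) / c j0 else 0)"
    have \<tau>j0: "\<tau> j0 \<noteq> k" "\<tau> j0 \<notin> \<tau> ` (S - {j0})"
      using \<tau> \<open>j0 \<in> S\<close> by (auto simp: inj_on_def)
    have "X \<in> ?H" using \<tau>j0 by (simp add: X_def inner_axis')
    moreover have "F X = \<Phi>"
    proof -
      have X\<tau>: "X $ \<tau> l $ j0 = - c l / c j0" if "l \<in> S - {j0}" for l
        using that \<tau> by (auto simp: X_def the_inv_into_f_f)
      have "F X $ i $ j0 = \<Phi> $ i $ j0" for i
      proof -
        have "(\<Sum>j\<in>S-{j0}. c j * \<Phi> $ i $ j) = (if i = k then 1 else 0) - c j0 * \<Phi> $ i $ j0"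
          using c[of i] \<open>j0 \<in> S\<close> by (simp add: sum.remove algebra_simps)
        moreover have "(\<Sum>l\<in>S-{j0}. X $ \<tau> l $ j0 * X $ i $ l)
            = - (\<Sum>j\<in>S-{j0}. c j * \<Phi> $ i $ j) / c j0"
          by (simp add: X\<tau> sum_divide_distrib flip: sum_negf) (simp add: X_def)
        moreover have "X $ k $ j0 = 1 / c j0" by (simp add: X_def)
        ultimately have "F X $ i $ j0 = (if i = k then 1 / c j0 else 0)
            - ((if i = k then 1 else 0) - c j0 * \<Phi> $ i $ j0) / c j0"
          by (simp add: F_def diff_divide_distrib)
        with \<open>c j0 \<noteq> 0\<close> show ?thesis by (simp add: diff_divide_distrib)
      qed
      moreover have "F X $ i $ j = \<Phi> $ i $ j" if "j \<noteq> j0" for i j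
        using that by (simp add: F_def X_def)
      ultimately show ?thesis by (metis vec_eq_iff)
    qed
    ultimately show "\<Phi> \<in> F ` ?H" by blast
  qed
  ultimately show ?thesis by (rule negligible_subset)
qed

definition degenerate :: "('k::scalar_field ^ 'm ^ 'n) set"
  where "degenerate = (\<Union>(k, S, j0) \<in> {(k, S, j0). card S < CARD('n) \<and> j0 \<in> S}. cols_span_axis k S j0)"

lemma negligible_degenerate: "negligible (degenerate :: ('k::scalar_field ^ 'm ^ 'n) set)"
  unfolding degenerate_def by (rule negligible_Union) (auto intro: negligible_cols_span_axis)

section \<open>Sparsity of duals, density and measure zero\<close>

lemma card_row_dual_ge:
  fixes \<Phi> \<Psi> :: "'k::scalar_field ^ 'm ^ 'n"
  assumes dual: "\<Psi> ** ctranspose \<Phi> = mat 1" and "\<Phi> \<notin> degenerate"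
  shows "CARD('n) \<le> card {j. \<Psi> $ k $ j \<noteq> 0}"
proof (rule ccontr)
  define S where "S = {j. \<Psi> $ k $ j \<noteq> 0}"
  assume "\<not> CARD('n) \<le> card {j. \<Psi> $ k $ j \<noteq> 0}"
  then have "card S < CARD('n)" by (simp add: S_def)
  \<comment> \<open>Conjugating row \<open>k\<close> of the duality equation expresses the
    \<open>k\<close>-th standard basis vector through the columns of \<open>\<Phi>\<close> indexed
    by the support of that row.\<close>
  have sum: "(\<Sum>j\<in>S. scnj (\<Psi> $ k $ j) * \<Phi> $ i $ j) = (if i = k then 1 else 0)" for i
  proof -
    have "(\<Sum>j\<in>S. scnj (\<Psi> $ k $ j) * \<Phi> $ i $ j) = (\<Sum>j\<in>UNIV. scnj (\<Psi> $ k $ j) * \<Phi> $ i $ j)"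
      by (intro sum.mono_neutral_left) (auto simp: S_def)
    also have "\<dots> = scnj ((\<Psi> ** ctranspose \<Phi>) $ k $ i)"
      by (simp add: matrix_matrix_mult_def ctranspose_def scnj_sum scnj_mult scnj_scnj)
    finally show ?thesis by (simp add: dual mat_def)
  qed
  have "S \<noteq> {}" using sum[of k] by auto
  then obtain j0 where "j0 \<in> S" by blast
  then have "\<Phi> \<in> cols_span_axis k S j0"
    unfolding cols_span_axis_def using sum
    by (auto simp: S_def intro!: exI[of _ "\<lambda>j. scnj (\<Psi> $ k $ j)"])
  with \<open>card S < CARD('n)\<close> \<open>j0 \<in> S\<close> \<open>\<Phi> \<notin> degenerate\<close> show False by (auto simp: degenerate_def)
qed

lemma frames_diff_degenerate_subset:
  "frames - degenerate \<subseteq> (frames_sparsest_dual_sq :: ('k::scalar_field ^ 'm ^ 'n) set)"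
proof
  fix \<Phi> :: "'k ^ 'm ^ 'n"
  assume \<Phi>: "\<Phi> \<in> frames - degenerate"
  have ge: "CARD('n)\<^sup>2 \<le> nnz \<Psi>" if "\<Psi> ** ctranspose \<Phi> = mat 1" for \<Psi>
    using sum_mono[of "UNIV :: 'n set" "\<lambda>_. CARD('n)"] card_row_dual_ge[OF that] \<Phi>
    by (simp add: nnz_eq_sum power2_eq_square)
  obtain \<Psi>0 where "\<Psi>0 ** ctranspose \<Phi> = mat 1"
    using \<Phi> by (auto simp: frames_def is_frame_iff_left_invertible)
  then obtain \<Psi> J where \<Psi>: "\<Psi> ** ctranspose \<Phi> = mat 1"
    and J: "card J = CARD('n)" "\<And>i j. j \<notin> J \<Longrightarrow> \<Psi> $ i $ j = 0"
    by (rule matrix_left_invertible_sparse) blast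
  \<comment> \<open>The n supporting columns allow at most n nonzero entries per row; with
    \<open>ge\<close> the total is then exactly the square.\<close>
  have "card {j. \<Psi> $ i $ j \<noteq> 0} \<le> CARD('n)" for i
    unfolding J(1)[symmetric] by (intro card_mono) (use J(2) in auto)
  then have "nnz \<Psi> \<le> CARD('n)\<^sup>2"
    using sum_mono[of "UNIV :: 'n set" _ "\<lambda>_. CARD('n)"] by (simp add: nnz_eq_sum power2_eq_square)
  with ge[OF \<Psi>] have "nnz \<Psi> = CARD('n)\<^sup>2" by simp
  with \<Psi> ge \<Phi> show "\<Phi> \<in> frames_sparsest_dual_sq"
    by (auto simp: frames_sparsest_dual_sq_def is_dual_frame_iff)
qed

lemma frames_approx_sparsest_dual_sq:
  fixes \<Phi> :: "'k::scalar_field ^ 'm ^ 'n"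
  assumes "\<Phi> \<in> frames" and "\<epsilon> > 0"
  shows "\<exists>\<Phi>' \<in> frames_sparsest_dual_sq. norm (\<Phi> - \<Phi>') < \<epsilon>"
proof -
  let ?U = "frames \<inter> ball \<Phi> \<epsilon>"
  have "open ?U" "?U \<noteq> {}"
    using assms centre_in_ball by (blast intro: open_frames open_Int open_ball)+
  \<comment> \<open>A nonempty open set has positive measure, so it cannot lie inside the negligible
    set \<open>degenerate\<close>.\<close>
  then have "\<not> negligible ?U" by (rule open_not_negligible)
  then have "\<not> ?U \<subseteq> degenerate" using negligible_degenerate negligible_subset by blast
  then show ?thesis using frames_diff_degenerate_subset by (fastforce simp: dist_norm)
qed

lemma null_sets_frames_diff_sparsest_dual_sq:
  "(frames - frames_sparsest_dual_sq :: ('k::scalar_field ^ 'm ^ 'n) set) \<in> null_sets lebesgue"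
proof -
  have "frames - frames_sparsest_dual_sq \<subseteq> (degenerate :: ('k ^ 'm ^ 'n) set)"
    using frames_diff_degenerate_subset by blast
  from negligible_subset[OF negligible_degenerate this] show ?thesis
    by (simp add: negligible_iff_null_sets)
qed

theorem theorem3p6:
  shows "((\<forall>\<Phi> \<in> (frames :: (real ^ 'm ^ 'n) set). \<forall>\<epsilon>>0.
            \<exists>\<Phi>' \<in> frames_sparsest_dual_sq. norm (\<Phi> - \<Phi>') < \<epsilon>)
          \<and> (frames - frames_sparsest_dual_sq :: (real ^ 'm ^ 'n) set) \<in> null_sets lebesgue)
       \<and> ((\<forall>\<Phi> \<in> (frames :: (complex ^ 'm ^ 'n) set). \<forall>\<epsilon>>0.
            \<exists>\<Phi>' \<in> frames_sparsest_dual_sq. norm (\<Phi> - \<Phi>') < \<epsilon>)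
          \<and> (frames - frames_sparsest_dual_sq :: (complex ^ 'm ^ 'n) set) \<in> null_sets lebesgue)"
  by (intro conjI ballI allI impI frames_approx_sparsest_dual_sq
      null_sets_frames_diff_sparsest_dual_sq)

end
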